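(* Let $\Phi=(A;\{E_i\}_{i=0}^d;A^*;\{E_i^*\}_{i=0}^d)$ be a tridiagonal system of diameter $d\geq 1$ on $V$ over $\mathbb{K}$, and let $\Delta,\Psi\in\mathrm{End}(V)$ be the linear transformations attached to $\Phi$ as defined in the context. Suppose $\Psi'\in\mathrm{End}(V)$ satisfies, for $0\le i\le d$, both $$\Psi'E_iV\subseteq E_{i-1}V+E_iV+E_{i+1}V,$$ $$\left(\Psi'-\frac{\Delta-I}{\theta_0-\theta_d}\right)E_i^*V\subseteq E_0^*V+E_1^*V+\cdots+E_{i-2}^*V.$$ Then $\Psi'=\Psi$.
   Context: $\mathbb{K}$ is a field, $V$ is a $\mathbb{K}$-vector space of finite positive dimension, $\mathrm{End}(V)$ is the algebra of linear maps $V\to V$, and $I$ is the identity. A tridiagonal pair (TD pair) on $V$ is an ordered pair $A,A^*\in\mathrm{End}(V)$ ($A^*$ is just a name, not an adjoint) such that: (i) $A$ and $A^*$ are each diagonalizable over $\mathbb{K}$; (ii) there is an ordering $\{V_i\}_{i=0}^d$ of the eigenspaces of $A$ with $A^*V_i\subseteq V_{i-1}+V_i+V_{i+1}$ for $0\le i\le d$, where $V_{-1}=V_{d+1}=0$; (iii) there is an ordering $\{V_i^*\}_{i=0}^{\delta}$ of the eigenspaces of $A^*$ with $AV_i^*\subseteq V_{i-1}^*+V_i^*+V_{i+1}^*$ for $0\le i\le\delta$, where $V_{-1}^*=V_{\delta+1}^*=0$; (iv) there is no subspace $W$ of $V$ with $AW\subseteq W$, $A^*W\subseteq W$, $W\ne0$,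 $W\ne V$. It is known that $d=\delta$; this is the diameter, and it is assumed that $d\ge1$. Orderings satisfying (ii) (resp. (iii)) are called standard. The primitive idempotent of a diagonalizable map associated with one of its eigenspaces is the projection of $V$ onto that eigenspace that kills the other eigenspaces. A tridiagonal system (TD system) on $V$ is a sequence $\Phi=(A;\{E_i\}_{i=0}^d;A^*;\{E_i^*\}_{i=0}^d)$ where $A,A^*$ is a TD pair on $V$, $\{E_i\}_{i=0}^d$ is an ordering of the primitive idempotents of $A$ such that $\{E_iV\}_{i=0}^d$ is standard, and $\{E_i^*\}_{i=0}^d$ is an ordering of the primitive idempotents of $A^*$ such that $\{E_i^*V\}_{i=0}^d$ is standard. Set $E_{-1}=E_{d+1}=0$. Let $\theta_i$ be the eigenvalue of $A$ on $E_iV$. An empty sum of subspaces is $0$ (so $E_0^*V+\cdots+E_{i-2}^*V=0$ for $i<2$). For $0\le i\le d$ set $U_i=(E_0^*V+\cdots+E_i^*V)\cap(E_iV+\cdots+E_dV)$ and $U_i^{\Downarrow}=(E_0^*V+\cdots+E_i^*V)\cap(E_0V+\cdots+E_{d-i}V)$. It is known that $V=\bigoplus_{i=0}^dU_i=\bigoplus_{i=0}^dU_i^{\Downarrow}$ (first and second split decompositions). Let $F_i$ be the projection of $V$ onto $U_i$ along $\bigoplus_{j\ne i}U_j$, and $F_i^{\Downarrow}$ the projection of $V$ onto $U_i^{\Downarrow}$ along $\bigoplus_{j\ne i}U_j^{\Downarrow}$. Define $\Delta=\sum_{h=0}^dF_h^{\Downarrow}F_h$. For $0\le i\le d/2$ set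 $K_i=(E_0^*V+\cdots+E_i^*V)\cap(E_iV+E_{i+1}V+\cdots+E_{d-i}V)$. For $0\le i\le j\le d+1$ set $\tau_{ij}=(x-\theta_i)(x-\theta_{i+1})\cdots(x-\theta_{j-1})\in\mathbb{K}[x]$, with $\tau_{ii}=1$ and $\tau_{i,i-1}=0$. For $0\le i\le d+1$ set $\vartheta_i=\sum_{h=0}^{i-1}\frac{\theta_h-\theta_{d-h}}{\theta_0-\theta_d}$. It is known that $V=\bigoplus_{0\le i\le d/2}\bigoplus_{j=i}^{d-i}\tau_{ij}(A)K_i$. $\Psi$ is the unique element of $\mathrm{End}(V)$ such that $\Psi\tau_{ij}(A)v=(\vartheta_j-\vartheta_i)\tau_{i,j-1}(A)v$ for all $0\le i\le d/2$, $i\le j\le d-i$, $v\in K_i$. *)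

theory Defs
  imports "HOL-Computational_Algebra.Polynomial" "HOL-Library.Set_Algebras"
begin

text \<open>
  The vector space is a whole type \<^typ>\<open>'v\<close> with an explicit scalar multiplication \<open>s\<close>
  over the field \<^typ>\<open>'k\<close>. Sums of subspaces are the setwise sums of
  \<^theory>\<open>HOL-Library.Set_Algebras\<close>; in particular an empty sum is \<open>{0}\<close>.
  In a finite sequence \<open>X\<^sub>0, \<dots>, X\<^sub>d\<close>, encoded as a function on \<^typ>\<open>nat\<close>, the values
  beyond \<open>d\<close> are irrelevant.
\<close>

type_synonym ('k, 'v) scaling = "'k \<Rightarrow> 'v \<Rightarrow> 'v"

definition eigenspace :: "('k::field, 'v::ab_group_add) scaling \<Rightarrow> ('v \<Rightarrow> 'v) \<Rightarrow> 'k \<Rightarrow> 'v set"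
  where "eigenspace s A t = {v. A v = s t v}"

definition eigenspaces :: "('k::field, 'v::ab_group_add) scaling \<Rightarrow> ('v \<Rightarrow> 'v) \<Rightarrow> 'v set set"
  where "eigenspaces s A = {eigenspace s A t | t. eigenspace s A t \<noteq> {0}}"

definition diagonalizable :: "('k::field, 'v::ab_group_add) scaling \<Rightarrow> ('v \<Rightarrow> 'v) \<Rightarrow> bool"
  where "diagonalizable s A \<longleftrightarrow> module.span s (\<Union>(eigenspaces s A)) = UNIV"

text \<open>
  The index set \<open>{j. j \<le> d \<and> i \<le> j + 1 \<and> j \<le> i + 1}\<close> consists of those of
  \<open>i - 1, i, i + 1\<close> that lie in \<open>{0..d}\<close>, so that \<open>X\<^bsub>-1\<^esub> = X\<^bsub>d+1\<^esub> = 0\<close>.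
\<close>

definition neighbour_sum :: "nat \<Rightarrow> (nat \<Rightarrow> 'v::ab_group_add set) \<Rightarrow> nat \<Rightarrow> 'v set"
  where "neighbour_sum d X i = (\<Sum>j | j \<le> d \<and> i \<le> j + 1 \<and> j \<le> i + 1. X j)"

definition standard_ordering ::
  "('k::field, 'v::ab_group_add) scaling \<Rightarrow> nat \<Rightarrow> ('v \<Rightarrow> 'v) \<Rightarrow> ('v \<Rightarrow> 'v) \<Rightarrow> (nat \<Rightarrow> 'v set) \<Rightarrow> bool"
  where "standard_ordering s d A B X \<longleftrightarrow>
    bij_betw X {..d} (eigenspaces s A) \<and> (\<forall>i\<le>d. B ` X i \<subseteq> neighbour_sum d X i)"

definition td_pair ::
  "('k::field, 'v::ab_group_add) scaling \<Rightarrow> ('v \<Rightarrow> 'v) \<Rightarrow> ('v \<Rightarrow> 'v) \<Rightarrow> bool"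
  where "td_pair s A As \<longleftrightarrow>
    Vector_Spaces.linear s s A \<and> Vector_Spaces.linear s s As \<and>
    diagonalizable s A \<and> diagonalizable s As \<and>
    (\<exists>d X. standard_ordering s d A As X) \<and>
    (\<exists>\<delta> X. standard_ordering s \<delta> As A X) \<and>
    (\<nexists>W. module.subspace s W \<and> A ` W \<subseteq> W \<and> As ` W \<subseteq> W \<and> W \<noteq> {0} \<and> W \<noteq> UNIV)"

text \<open>The projection onto \<open>W\<close> along \<open>Z\<close>, meaningful when the space is the direct sum of both.\<close>

definition proj_along :: "'v::ab_group_add set \<Rightarrow> 'v set \<Rightarrow> 'v \<Rightarrow> 'v"
  where "proj_along W Z v = (THE w. w \<in> W \<and> v - w \<in> Z)"

definition primitive_idempotent ::
  "('k::field, 'v::ab_group_add) scaling \<Rightarrow> ('v \<Rightarrow> 'v) \<Rightarrow> 'v set \<Rightarrow> 'v \<Rightarrow> 'v"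
  where "primitive_idempotent s A W =
    proj_along W (module.span s (\<Union>(eigenspaces s A - {W})))"

definition td_system ::
  "('k::field, 'v::ab_group_add) scaling \<Rightarrow> nat \<Rightarrow> ('v \<Rightarrow> 'v) \<Rightarrow> (nat \<Rightarrow> 'v \<Rightarrow> 'v) \<Rightarrow>
    ('v \<Rightarrow> 'v) \<Rightarrow> (nat \<Rightarrow> 'v \<Rightarrow> 'v) \<Rightarrow> bool"
  where "td_system s d A E As Es \<longleftrightarrow>
    td_pair s A As \<and>
    bij_betw E {..d} (primitive_idempotent s A ` eigenspaces s A) \<and>
    standard_ordering s d A As (\<lambda>i. range (E i)) \<and>
    bij_betw Es {..d} (primitive_idempotent s As ` eigenspaces s As) \<and>
    standard_ordering s d As A (\<lambda>i. range (Es i))"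

definition theta ::
  "('k::field, 'v::ab_group_add) scaling \<Rightarrow> ('v \<Rightarrow> 'v) \<Rightarrow> (nat \<Rightarrow> 'v \<Rightarrow> 'v) \<Rightarrow> nat \<Rightarrow> 'k"
  where "theta s A E i = (THE t. \<forall>v\<in>range (E i). A v = s t v)"

definition split1 :: "nat \<Rightarrow> (nat \<Rightarrow> 'v \<Rightarrow> 'v) \<Rightarrow> (nat \<Rightarrow> 'v \<Rightarrow> 'v) \<Rightarrow> nat \<Rightarrow> 'v::ab_group_add set"
  where "split1 d E Es i = (\<Sum>j\<in>{0..i}. range (Es j)) \<inter> (\<Sum>j\<in>{i..d}. range (E j))"

definition split2 :: "nat \<Rightarrow> (nat \<Rightarrow> 'v \<Rightarrow> 'v) \<Rightarrow> (nat \<Rightarrow> 'v \<Rightarrow> 'v) \<Rightarrow> nat \<Rightarrow> 'v::ab_group_add set"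
  where "split2 d E Es i = (\<Sum>j\<in>{0..i}. range (Es j)) \<inter> (\<Sum>j\<in>{0..d-i}. range (E j))"

definition split_proj :: "nat \<Rightarrow> (nat \<Rightarrow> 'v set) \<Rightarrow> nat \<Rightarrow> 'v \<Rightarrow> 'v::ab_group_add"
  where "split_proj d U i = proj_along (U i) (\<Sum>j\<in>{0..d} - {i}. U j)"

definition Delta :: "nat \<Rightarrow> (nat \<Rightarrow> 'v \<Rightarrow> 'v) \<Rightarrow> (nat \<Rightarrow> 'v \<Rightarrow> 'v) \<Rightarrow> 'v \<Rightarrow> 'v::ab_group_add"
  where "Delta d E Es v =
    (\<Sum>h=0..d. split_proj d (split2 d E Es) h (split_proj d (split1 d E Es) h v))"

definition Kspace :: "nat \<Rightarrow> (nat \<Rightarrow> 'v \<Rightarrow> 'v) \<Rightarrow> (nat \<Rightarrow> 'v \<Rightarrow> 'v) \<Rightarrow> nat \<Rightarrow> 'v::ab_group_add set"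
  where "Kspace d E Es i = (\<Sum>j\<in>{0..i}. range (Es j)) \<inter> (\<Sum>j\<in>{i..d-i}. range (E j))"

definition poly_op :: "('k::field, 'v::ab_group_add) scaling \<Rightarrow> 'k poly \<Rightarrow> ('v \<Rightarrow> 'v) \<Rightarrow> 'v \<Rightarrow> 'v"
  where "poly_op s p A v = (\<Sum>k\<le>degree p. s (coeff p k) ((A ^^ k) v))"

text \<open>
  The second index is an integer so that \<open>\<tau>\<^bsub>i,i-1\<^esub> = 0\<close> makes sense also for \<open>i = 0\<close>.
\<close>

definition tau :: "(nat \<Rightarrow> 'k::field) \<Rightarrow> nat \<Rightarrow> int \<Rightarrow> 'k poly"
  where "tau \<theta> i j = (if j < int i then 0 else (\<Prod>h\<in>{i..<nat j}. [:- \<theta> h, 1:]))"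

definition vartheta :: "(nat \<Rightarrow> 'k::field) \<Rightarrow> nat \<Rightarrow> nat \<Rightarrow> 'k"
  where "vartheta \<theta> d i = (\<Sum>h<i. (\<theta> h - \<theta> (d - h)) / (\<theta> 0 - \<theta> d))"

definition Psi ::
  "('k::field, 'v::ab_group_add) scaling \<Rightarrow> nat \<Rightarrow> ('v \<Rightarrow> 'v) \<Rightarrow> (nat \<Rightarrow> 'v \<Rightarrow> 'v) \<Rightarrow>
    (nat \<Rightarrow> 'v \<Rightarrow> 'v) \<Rightarrow> 'v \<Rightarrow> 'v"
  where "Psi s d A E Es = (let \<theta> = theta s A E in
    THE P. Vector_Spaces.linear s s P \<and>
      (\<forall>i j. \<forall>v\<in>Kspace d E Es i. 2 * i \<le> d \<longrightarrow> i \<le> j \<longrightarrow> j \<le> d - i \<longrightarrow>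
        P (poly_op s (tau \<theta> i (int j)) A v) =
          s (vartheta \<theta> d j - vartheta \<theta> d i) (poly_op s (tau \<theta> i (int j - 1)) A v)))"

end

theory Submission
  imports Defs
begin

text \<open>
  Write \<open>X\<^sub>i\<close> and \<open>Y\<^sub>i\<close> for the eigenspaces of \<open>A\<close> and \<open>A\<^sup>*\<close> in their standard orderings.
  The proof checks that \<open>\<Psi>'\<close> itself satisfies the equations
  \<open>\<Psi>' \<tau>\<^sub>i\<^sub>j(A) v = (\<vartheta>\<^sub>j - \<vartheta>\<^sub>i) \<tau>\<^sub>i\<^sub>,\<^sub>j\<^sub>-\<^sub>1(A) v\<close> with \<open>v \<in> K\<^sub>i\<close> that define \<open>\<Psi>\<close>. As the vectors
  \<open>\<tau>\<^sub>i\<^sub>j(A) v\<close> span the space, these equations have at most one linear solution, so \<open>\<Psi>' = \<Psi>\<close>;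
  the existence of \<open>\<Psi>\<close> comes for free, \<open>\<Psi>'\<close> being a witness.

  Everything rests on one vanishing statement (\<open>low_Int_high\<close>): a vector in
  \<open>Y\<^sub>0 + \<dots> + Y\<^bsub>n-1\<^esub>\<close> and in \<open>X\<^sub>n + \<dots> + X\<^sub>d\<close> is zero. It holds because the sum of these
  intersections over all \<open>n\<close> is invariant under \<open>A\<close> and \<open>A\<^sup>*\<close> and is contained in the proper
  subspace \<open>X\<^sub>1 + \<dots> + X\<^sub>d\<close>, so irreducibility makes it zero. The same argument with the indices
  shifted by one shows that the \<open>U\<^sub>n\<close> span the space.

  For the equations (\<open>psi_formula_on_raise_K\<close>), put
  \<open>\<eta>\<^sub>i\<^sub>j = (x - \<theta>\<^bsub>d-i\<^esub>) \<cdots> (x - \<theta>\<^bsub>d-j+1\<^esub>)\<close>. Both \<open>\<tau>\<^sub>i\<^sub>j\<close> and \<open>\<eta>\<^sub>i\<^sub>j\<close> are monic of degree \<open>j - i\<close>, and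
  for \<open>v \<in> K\<^sub>i\<close> the vectors \<open>\<tau>\<^sub>i\<^sub>j(A) v\<close> and \<open>\<eta>\<^sub>i\<^sub>j(A) v\<close> lie in \<open>U\<^sub>j\<close> and \<open>U\<^sub>j\<^sup>\<Down>\<close>. Hence
  \<open>\<Delta> \<tau>\<^sub>i\<^sub>j(A) v = \<eta>\<^sub>i\<^sub>j(A) v\<close>, and comparing the subleading coefficients shows that
  \<open>(\<Delta> - I) \<tau>\<^sub>i\<^sub>j(A) v / (\<theta>\<^sub>0 - \<theta>\<^sub>d)\<close> equals \<open>(\<vartheta>\<^sub>j - \<vartheta>\<^sub>i) \<tau>\<^sub>i\<^sub>,\<^sub>j\<^sub>-\<^sub>1(A) v\<close> up to
  \<open>Y\<^sub>0 + \<dots> + Y\<^bsub>j-2\<^esub>\<close>. By the second hypothesis on \<open>\<Psi>'\<close> the same is true of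
  \<open>\<Psi>' \<tau>\<^sub>i\<^sub>j(A) v\<close>. By the first one the error also lies in \<open>X\<^bsub>j-1\<^esub> + \<dots> + X\<^sub>d\<close>, so it vanishes.

  The spanning statement (\<open>span_raise_K\<close>) follows as in the representation theory of
  \<open>sl\<^sub>2\<close>, once \<open>\<tau>\<^bsub>i,d-i\<^esub>(A)\<close> is known to map \<open>U\<^sub>i\<close> onto \<open>U\<^bsub>d-i\<^esub>\<close>. That map is injective by the
  vanishing statement for the reversed ordering \<open>X\<^sub>d, \<dots>, X\<^sub>0\<close>, and the two spaces have the same
  dimension.
\<close>

section \<open>Spans of families, projections and polynomials in an operator\<close>

context vector_space
begin

lemma sum_subspaces_eq_span:
  assumes "finite J" "\<And>j. j \<in> J \<Longrightarrow> subspace (X j)"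
  shows "(\<Sum>j\<in>J. X j) = span (\<Union>j\<in>J. X j)"
  using assms
proof (induction J)
  case empty
  then show ?case by (simp add: set_zero)
next
  case (insert j J)
  have "(\<Sum>j\<in>insert j J. X j) = X j + span (\<Union>j\<in>J. X j)" using insert by simp
  also have "X j = span (X j)" using insert.prems by (metis insertI1 span_eq_iff)
  also have "span (X j) + span (\<Union>j\<in>J. X j) = span (\<Union>j\<in>insert j J. X j)"
    by (auto simp: span_Un set_plus_def)
  finally show ?case .
qed

lemma span_UN_sum:
  assumes "v \<in> span (\<Union>j\<in>J \<union> K. X j)"
  obtains a b where "a \<in> span (\<Union>j\<in>J. X j)" "b \<in> span (\<Union>j\<in>K. X j)" "v = a + b"
  using assms by (auto simp: UN_Un span_Un)

lemma span_UN_mono: "v \<in> span (\<Union>j\<in>J. X j) \<Longrightarrow> J \<subseteq> K \<Longrightarrow> v \<in> span (\<Union>j\<in>K. X j)"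
  using span_mono[of "\<Union>j\<in>J. X j" "\<Union>j\<in>K. X j"] by blast

lemma span_UN_base: "x \<in> X j \<Longrightarrow> j \<in> J \<Longrightarrow> x \<in> span (\<Union>j\<in>J. X j)"
  by (rule span_base) blast

lemma span_UN_into:
  assumes "v \<in> span (\<Union>j\<in>J. X j)" "subspace W" "\<And>j x. j \<in> J \<Longrightarrow> x \<in> X j \<Longrightarrow> x \<in> W"
  shows "v \<in> W"
  using span_minimal[of "\<Union>j\<in>J. X j" W] assms by blast

lemma linear_map_add: "Vector_Spaces.linear scale scale f \<Longrightarrow> f (x + y) = f x + f y"
  and linear_map_scale: "Vector_Spaces.linear scale scale f \<Longrightarrow> f (scale c x) = scale c (f x)"
  by (simp_all add: Vector_Spaces.linear_iff)

lemma linear_map_0: "Vector_Spaces.linear scale scale f \<Longrightarrow> f 0 = 0"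
  using linear_map_add[of f 0 0] by simp

lemma linear_map_diff: "Vector_Spaces.linear scale scale f \<Longrightarrow> f (x - y) = f x - f y"
  using linear_map_add[of f "x - y" y] by simp

lemma linear_intro:
  assumes "\<And>x y. f (x + y) = f x + f y" "\<And>c x. f (scale c x) = scale c (f x)"
  shows "Vector_Spaces.linear scale scale f"
  using assms by (simp add: Vector_Spaces.linear_iff vector_space_axioms)

lemma linear_map_shift:
  assumes "Vector_Spaces.linear scale scale f"
  shows "Vector_Spaces.linear scale scale (\<lambda>v. f v - scale c v)"
  by (rule linear_intro)
    (simp_all add: linear_map_add[OF assms] linear_map_scale[OF assms] algebra_simps)

lemma linear_span_UN_into:
  assumes "Vector_Spaces.linear scale scale f" "v \<in> span (\<Union>j\<in>J. X j)" "subspace W"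
    and "\<And>j x. j \<in> J \<Longrightarrow> x \<in> X j \<Longrightarrow> f x \<in> W"
  shows "f v \<in> W"
proof -
  have "subspace {v. f v \<in> W}"
    using assms(3) by (auto simp: subspace_def linear_map_0[OF assms(1)]
        linear_map_add[OF assms(1)] linear_map_scale[OF assms(1)])
  from span_UN_into[OF assms(2) this] assms(4) show ?thesis by blast
qed

lemma proj_along_eq:
  assumes "subspace W" "subspace Z" "W \<inter> Z = {0}" "w \<in> W" "v - w \<in> Z"
  shows "proj_along W Z v = w"
  unfolding proj_along_def
proof (rule the_equality)
  fix w' assume w': "w' \<in> W \<and> v - w' \<in> Z"
  have "w' - w \<in> W" using w' assms(1,4) by (simp add: subspace_diff)
  moreover have "(v - w) - (v - w') \<in> Z" using w' assms(2,5) subspace_diff by blast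
  ultimately have "w' - w \<in> W \<inter> Z" by simp
  then show "w' = w" using assms(3) by simp
qed (use assms in simp)

lemma linear_proj_along:
  assumes "subspace W" "subspace Z" "W \<inter> Z = {0}" and ex: "\<And>v. \<exists>w\<in>W. v - w \<in> Z"
  shows "Vector_Spaces.linear scale scale (proj_along W Z)"
proof (rule linear_intro)
  note eq = proj_along_eq[OF assms(1-3)]
  fix x y c
  obtain u w where u: "u \<in> W" "x - u \<in> Z" and w: "w \<in> W" "y - w \<in> Z" using ex by blast
  have "(x - u) + (y - w) \<in> Z" using u w assms(2) by (simp add: subspace_add)
  then have "(x + y) - (u + w) \<in> Z" by (simp add: algebra_simps)
  then have "proj_along W Z (x + y) = u + w"
    using u w assms(1) by (intro eq) (simp_all add: subspace_add)
  then show "proj_along W Z (x + y) = proj_along W Z x + proj_along W Z y"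
    using u w by (simp add: eq)
  have "scale c (x - u) \<in> Z" using u assms(2) by (simp add: subspace_scale)
  then have "scale c x - scale c u \<in> Z" by (simp add: scale_right_diff_distrib)
  then have "proj_along W Z (scale c x) = scale c u"
    using u assms(1) by (intro eq) (simp_all add: subspace_scale)
  then show "proj_along W Z (scale c x) = scale c (proj_along W Z x)"
    using u by (simp add: eq)
qed

lemma subspace_eigenspace:
  assumes "Vector_Spaces.linear scale scale A"
  shows "subspace (eigenspace scale A t)"
  unfolding eigenspace_def
  by (auto simp: subspace_def linear_map_0[OF assms] linear_map_add[OF assms]
      linear_map_scale[OF assms] scale_right_distrib mult.commute)

lemma poly_op_0: "poly_op scale 0 A v = 0"
  and poly_op_1: "poly_op scale 1 A v = v"
  by (simp_all add: poly_op_def)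

text \<open>
  Two polynomials of different degree can be compared coefficientwise only when both are
  evaluated with the same summation bound.
\<close>

lemma poly_op_altdef:
  assumes "degree p \<le> n"
  shows "poly_op scale p A v = (\<Sum>k\<le>n. scale (coeff p k) ((A ^^ k) v))"
  unfolding poly_op_def using assms
  by (intro sum.mono_neutral_left) (auto simp: coeff_eq_0)

lemma poly_op_linear_factor:
  assumes "Vector_Spaces.linear scale scale A"
  shows "poly_op scale ([:- c, 1:] * p) A v = A (poly_op scale p A v) - scale c (poly_op scale p A v)"
proof -
  let ?n = "degree p"
  have A_sum: "A (\<Sum>k\<le>n. f k) = (\<Sum>k\<le>n. A (f k))" for f and n :: nat
    by (induction n) (simp_all add: linear_map_add[OF assms])
  have "degree ([:- c, 1:] * p) \<le> Suc ?n"
    using degree_mult_le[of "[:- c, 1:]" p] by simp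
  then have "poly_op scale ([:- c, 1:] * p) A v
      = (\<Sum>k\<le>Suc ?n. scale (coeff ([:- c, 1:] * p) k) ((A ^^ k) v))"
    by (rule poly_op_altdef)
  also have "\<dots> = (\<Sum>k\<le>Suc ?n. scale (coeff (pCons 0 p) k) ((A ^^ k) v))
      - (\<Sum>k\<le>Suc ?n. scale (c * coeff p k) ((A ^^ k) v))"
    unfolding sum_subtractf[symmetric]
    by (intro sum.cong) (simp_all add: algebra_simps)
  also have "(\<Sum>k\<le>Suc ?n. scale (coeff (pCons 0 p) k) ((A ^^ k) v))
      = (\<Sum>k\<le>?n. scale (coeff p k) (A ((A ^^ k) v)))"
    by (subst sum.atMost_Suc_shift) simp
  also have "\<dots> = A (poly_op scale p A v)"
    by (simp add: poly_op_def A_sum linear_map_scale[OF assms])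
  also have "(\<Sum>k\<le>Suc ?n. scale (c * coeff p k) ((A ^^ k) v)) = scale c (poly_op scale p A v)"
    by (simp add: poly_op_altdef[of p "Suc ?n"] coeff_eq_0 scale_sum_right scale_right_distrib)
  finally show ?thesis .
qed

end

lemma (in finite_dimensional_vector_space) dim_direct_sum:
  assumes "subspace S" "subspace T" "subspace W" "S \<subseteq> W" "T \<subseteq> W" "S \<inter> T = {0}"
    and ex: "\<And>v. v \<in> W \<Longrightarrow> \<exists>a\<in>S. v - a \<in> T"
  shows "dim S + dim T = dim W"
proof -
  have "W = {x + y |x y. x \<in> S \<and> y \<in> T}"
  proof
    show "W \<subseteq> {x + y |x y. x \<in> S \<and> y \<in> T}"
    proof
      fix v assume "v \<in> W"
      then obtain a where "a \<in> S" "v - a \<in> T" using ex by blast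
      moreover have "v = a + (v - a)" by simp
      ultimately show "v \<in> {x + y |x y. x \<in> S \<and> y \<in> T}" by blast
    qed
    show "{x + y |x y. x \<in> S \<and> y \<in> T} \<subseteq> W"
      using assms by (auto intro: subspace_add)
  qed
  then show ?thesis using dim_sums_Int[OF assms(1,2)] assms(6) by simp
qed

section \<open>Eigenspace flags and the split decomposition\<close>

text \<open>
  A tridiagonal system seen only through its eigenspaces, with \<open>X i\<close> in the role of \<open>E\<^sub>iV\<close> and \<open>Y i\<close>
  in that of \<open>E\<^sub>i\<^sup>*V\<close>. In this form the reversed ordering \<open>X (d - i)\<close> is again an instance, which
  turns facts about the first split decomposition into facts about the second one.
\<close>

locale td_flags = finite_dimensional_vector_space scale Basis
  for scale :: "'k::field \<Rightarrow> 'v::ab_group_add \<Rightarrow> 'v" (infixr \<open>*s\<close> 75) and Basis :: "'v set" +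
  fixes d :: nat and A As :: "'v \<Rightarrow> 'v" and X Y :: "nat \<Rightarrow> 'v set" and \<theta> \<theta>s :: "nat \<Rightarrow> 'k"
  assumes A_linear: "Vector_Spaces.linear scale scale A"
    and As_linear: "Vector_Spaces.linear scale scale As"
    and X_eigenspace: "\<And>i. i \<le> d \<Longrightarrow> X i = eigenspace scale A (\<theta> i)"
    and Y_eigenspace: "\<And>i. i \<le> d \<Longrightarrow> Y i = eigenspace scale As (\<theta>s i)"
    and \<theta>_inj: "inj_on \<theta> {..d}"
    and X_nonzero: "\<And>i. i \<le> d \<Longrightarrow> X i \<noteq> {0}"
    and Y_nonzero: "Y 0 \<noteq> {0}"
    and X_span: "span (\<Union>i\<le>d. X i) = UNIV"
    and As_X: "\<And>i x. i \<le> d \<Longrightarrow> x \<in> X i \<Longrightarrow>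
      As x \<in> span (\<Union>j\<in>{j. j \<le> d \<and> i \<le> j + 1 \<and> j \<le> i + 1}. X j)"
    and A_Y: "\<And>i y. i \<le> d \<Longrightarrow> y \<in> Y i \<Longrightarrow>
      A y \<in> span (\<Union>j\<in>{j. j \<le> d \<and> i \<le> j + 1 \<and> j \<le> i + 1}. Y j)"
    and irreducible: "\<And>W. subspace W \<Longrightarrow> A ` W \<subseteq> W \<Longrightarrow> As ` W \<subseteq> W \<Longrightarrow> W = {0} \<or> W = UNIV"
begin

text \<open>
  The upper index of \<open>low\<close> is exclusive, so that \<open>low 0\<close> is the empty sum and the vanishing
  statement takes the symmetric form \<open>low n \<inter> high n = {0}\<close>.
\<close>

definition low :: "nat \<Rightarrow> 'v set"
  where "low n = span (\<Union>j<n. Y j)"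

definition high :: "nat \<Rightarrow> 'v set"
  where "high n = span (\<Union>j\<in>{n..d}. X j)"

definition split :: "nat \<Rightarrow> 'v set"
  where "split n = low (Suc n) \<inter> high n"

lemmas A_add = linear_map_add[OF A_linear]
  and A_diff = linear_map_diff[OF A_linear]
  and A_scale = linear_map_scale[OF A_linear]
  and A_0 = linear_map_0[OF A_linear]

lemma subspace_X: "i \<le> d \<Longrightarrow> subspace (X i)"
  by (simp add: X_eigenspace subspace_eigenspace A_linear)

lemma subspace_low: "subspace (low n)"
  and subspace_high: "subspace (high n)"
  and subspace_split: "subspace (split n)"
  by (simp_all add: low_def high_def split_def subspace_inter)

lemma A_X: "i \<le> d \<Longrightarrow> x \<in> X i \<Longrightarrow> A x = \<theta> i *s x"
  by (simp add: X_eigenspace eigenspace_def)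

lemma As_Y: "i \<le> d \<Longrightarrow> y \<in> Y i \<Longrightarrow> As y = \<theta>s i *s y"
  by (simp add: Y_eigenspace eigenspace_def)

lemma low_mono: "v \<in> low m \<Longrightarrow> m \<le> n \<Longrightarrow> v \<in> low n"
  unfolding low_def by (erule span_UN_mono) auto

lemma high_mono: "v \<in> high m \<Longrightarrow> n \<le> m \<Longrightarrow> v \<in> high n"
  unfolding high_def by (erule span_UN_mono) auto

lemma low_0: "low 0 = {0}"
  and high_Suc_d: "high (Suc d) = {0}"
  and high_0: "high 0 = UNIV"
  using X_span by (simp_all add: low_def high_def atLeast0AtMost)

lemma A_low: "v \<in> low n \<Longrightarrow> n \<le> Suc d \<Longrightarrow> A v \<in> low (Suc n)"
  unfolding low_def
  by (erule linear_span_UN_into[OF A_linear]) (rule subspace_span, rule span_UN_mono[OF A_Y], auto)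

text \<open>
  Here and in \<open>A_raise\<close>, subtracting the eigenvalue at the end of a flag removes the eigenspace
  at that end, while the other operator moves this end by at most one step.
\<close>

lemma As_lower:
  assumes "v \<in> low (Suc n)" "n \<le> d"
  shows "As v - \<theta>s n *s v \<in> low n"
  using assms(1) unfolding low_def
proof (rule linear_span_UN_into[OF linear_map_shift[OF As_linear]])
  fix j y assume j: "j \<in> {..<Suc n}" and y: "y \<in> Y j"
  then have eq: "As y - \<theta>s n *s y = (\<theta>s j - \<theta>s n) *s y"
    using assms(2) by (simp add: As_Y scale_left_diff_distrib)
  show "As y - \<theta>s n *s y \<in> span (\<Union>j<n. Y j)"
  proof (cases "j = n")
    case False
    then have "y \<in> span (\<Union>j<n. Y j)" using j y by (intro span_UN_base) auto
    then show ?thesis unfolding eq by (rule span_scale)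
  qed (simp add: eq span_zero)
qed simp

lemma A_span_X:
  assumes "v \<in> span (\<Union>j\<in>J. X j)" "J \<subseteq> {..d}" shows "A v \<in> span (\<Union>j\<in>J. X j)"
  using assms(1)
proof (rule linear_span_UN_into[OF A_linear])
  fix j x assume "j \<in> J" "x \<in> X j"
  then have "x \<in> span (\<Union>j\<in>J. X j)" "A x = \<theta> j *s x"
    using assms(2) by (auto intro: A_X span_UN_base)
  then show "A x \<in> span (\<Union>j\<in>J. X j)" by (simp add: span_scale)
qed simp

lemma A_high: "v \<in> high n \<Longrightarrow> A v \<in> high n"
  unfolding high_def by (erule A_span_X) auto

lemma A_raise:
  assumes "v \<in> high n" shows "A v - \<theta> n *s v \<in> high (Suc n)"
  using assms unfolding high_def
proof (rule linear_span_UN_into[OF linear_map_shift[OF A_linear]])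
  fix j x assume j: "j \<in> {n..d}" and x: "x \<in> X j"
  then have eq: "A x - \<theta> n *s x = (\<theta> j - \<theta> n) *s x"
    by (simp add: A_X scale_left_diff_distrib)
  show "A x - \<theta> n *s x \<in> span (\<Union>j\<in>{Suc n..d}. X j)"
  proof (cases "j = n")
    case False
    then have "x \<in> span (\<Union>j\<in>{Suc n..d}. X j)" using j x by (intro span_UN_base) auto
    then show ?thesis unfolding eq by (rule span_scale)
  qed (simp add: eq span_zero)
qed simp

lemma As_high: "v \<in> high n \<Longrightarrow> As v \<in> high (n - 1)"
  unfolding high_def
  by (erule linear_span_UN_into[OF As_linear]) (auto intro!: span_UN_mono[OF As_X])

text \<open>
  The operator \<open>A - \<theta> k\<close> removes the component in \<open>X k\<close> from the span and multiplies \<open>x\<close> by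
  a nonzero scalar, which shortens the index set.
\<close>

lemma eigenvector_not_in_span_others:
  assumes "finite K" "K \<subseteq> {..d}" "h \<le> d" "h \<notin> K" "x \<in> X h" "x \<in> span (\<Union>k\<in>K. X k)"
  shows "x = 0"
  using assms
proof (induction K arbitrary: x)
  case (insert k K)
  have "x \<in> span (\<Union>j\<in>{k} \<union> K. X j)" using insert.prems by simp
  then obtain a b where a: "a \<in> span (\<Union>j\<in>{k}. X j)" and b: "b \<in> span (\<Union>j\<in>K. X j)"
    and x: "x = a + b" by (rule span_UN_sum)
  have "a \<in> X k" using a insert.prems subspace_X[of k] by simp (metis span_eq_iff)
  then have "A a = \<theta> k *s a" using insert.prems by (simp add: A_X)
  then have "A x - \<theta> k *s x = A b - \<theta> k *s b" by (simp add: x A_add scale_right_distrib)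
  also have "A x - \<theta> k *s x = (\<theta> h - \<theta> k) *s x"
    using insert.prems by (simp add: A_X scale_left_diff_distrib)
  finally have eq: "(\<theta> h - \<theta> k) *s x = A b - \<theta> k *s b" .
  have "A b - \<theta> k *s b \<in> span (\<Union>j\<in>K. X j)"
    using A_span_X[OF b] b insert.prems by (auto intro: span_diff span_scale)
  then have "(\<theta> h - \<theta> k) *s x \<in> span (\<Union>j\<in>K. X j)" by (simp only: eq)
  moreover have "(\<theta> h - \<theta> k) *s x \<in> X h"
    using insert.prems subspace_X[of h] by (auto intro: subspace_scale)
  ultimately have "(\<theta> h - \<theta> k) *s x = 0" using insert.IH insert.prems by blast
  moreover have "\<theta> h \<noteq> \<theta> k"
    using insert.prems inj_onD[OF \<theta>_inj, of h k] by auto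
  ultimately show ?case by simp
qed simp

text \<open>
  On the summand with index \<open>n\<close>, \<open>A - \<theta> n\<close> leads to the summand with index \<open>n + 1\<close> and
  \<open>A\<^sup>* - \<theta>s (n + r - 1)\<close> to the one with index \<open>n - 1\<close>; at both ends the result is zero. For
  \<open>r = 0\<close> the summands are the intersections that turn out to vanish, for \<open>r = 1\<close> they are
  the spaces \<open>split n\<close>.
\<close>

lemma ladder_invariant:
  assumes "r \<le> 1"
  defines "W \<equiv> span (\<Union>n\<in>{..d}. low (n + r) \<inter> high n)"
  shows "W = {0} \<or> W = UNIV"
proof (rule irreducible)
  show "subspace W" by (simp add: W_def)
  have base: "v \<in> W" if "v \<in> low (n + r)" "v \<in> high n" for v n
  proof (cases "n \<le> d")
    case True
    then show ?thesis unfolding W_def using that by (intro span_UN_base[of _ _ n]) auto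
  next
    case False
    then have "v = 0" using high_mono[OF that(2), of "Suc d"] by (simp add: high_Suc_d)
    then show ?thesis by (simp add: W_def span_zero)
  qed
  show "A ` W \<subseteq> W"
  proof safe
    fix v assume "v \<in> W"
    then show "A v \<in> W" unfolding W_def
    proof (rule linear_span_UN_into[OF A_linear], fold W_def)
      fix n v assume n: "n \<in> {..d}" and v: "v \<in> low (n + r) \<inter> high n"
      have "A v - \<theta> n *s v \<in> low (Suc n + r)"
        using A_low[of v "n + r"] v n assms(1) low_mono[of v "n + r" "Suc n + r"] subspace_low
        by (auto intro: subspace_diff subspace_scale)
      then have "A v - \<theta> n *s v \<in> W" using v A_raise by (intro base) auto
      moreover have "\<theta> n *s v \<in> W" using v base \<open>subspace W\<close> by (auto intro: subspace_scale)
      ultimately have "A v - \<theta> n *s v + \<theta> n *s v \<in> W"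
        using \<open>subspace W\<close> by (rule subspace_add[rotated])
      then show "A v \<in> W" by simp
    qed (simp add: W_def)
  qed
  show "As ` W \<subseteq> W"
  proof safe
    fix v assume "v \<in> W"
    then show "As v \<in> W" unfolding W_def
    proof (rule linear_span_UN_into[OF As_linear], fold W_def)
      fix n v assume n: "n \<in> {..d}" and v: "v \<in> low (n + r) \<inter> high n"
      show "As v \<in> W"
      proof (cases "n + r")
        case 0
        then have "v = 0" using v by (simp add: low_0)
        then show ?thesis using linear_map_0[OF As_linear] by (simp add: W_def span_zero)
      next
        case (Suc k)
        have low: "As v - \<theta>s k *s v \<in> low k" using As_lower[of v k] v n Suc assms(1) by auto
        have "As v - \<theta>s k *s v \<in> high (n - 1)"
          using As_high[of v n] high_mono[of v n "n - 1"] v subspace_high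
          by (auto intro: subspace_diff subspace_scale)
        moreover have "low k \<subseteq> low (n - 1 + r)" using Suc by (auto elim: low_mono)
        ultimately have "As v - \<theta>s k *s v \<in> W" using low base by blast
        moreover have "\<theta>s k *s v \<in> W" using v base \<open>subspace W\<close> by (auto intro: subspace_scale)
        ultimately have "As v - \<theta>s k *s v + \<theta>s k *s v \<in> W"
          using \<open>subspace W\<close> by (rule subspace_add[rotated])
        then show ?thesis by simp
      qed
    qed (simp add: W_def)
  qed
qed

text \<open>
  For \<open>r = 0\<close> the invariant subspace of \<open>ladder_invariant\<close> cannot be everything: \<open>low 0 = {0}\<close>, so it is contained in
  \<open>high 1\<close>, which misses the eigenvectors in \<open>X 0\<close>.
\<close>

lemma low_Int_high:
  assumes "v \<in> low n" "v \<in> high n" "n \<le> Suc d"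
  shows "v = 0"
proof (cases "n = Suc d")
  case True
  then show ?thesis using assms by (simp add: high_Suc_d)
next
  case False
  let ?W = "span (\<Union>n\<in>{..d}. low (n + 0) \<inter> high n)"
  have "w \<in> high 1" if "w \<in> ?W" for w
    using that
  proof (rule span_UN_into)
    fix n x assume "n \<in> {..d}" "x \<in> low (n + 0) \<inter> high n"
    then show "x \<in> high 1" using subspace_0[OF subspace_high]
      by (cases "n = 0") (auto simp: low_0 elim: high_mono)
  qed (rule subspace_high)
  moreover obtain x where "x \<in> X 0" "x \<noteq> 0"
    using X_nonzero[of 0] subspace_X[of 0] subspace_0 by blast
  moreover have "x \<notin> high 1"
    using eigenvector_not_in_span_others[of "{1..d}" 0 x] \<open>x \<in> X 0\<close> \<open>x \<noteq> 0\<close>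
    by (auto simp: high_def)
  ultimately have "?W \<noteq> UNIV" by blast
  then have "?W = {0}" using ladder_invariant[of 0] by simp
  moreover have "v \<in> ?W" using assms False by (intro span_UN_base[of _ _ n]) auto
  ultimately show ?thesis by simp
qed

text \<open>
  For \<open>r = 1\<close> the invariant subspace of \<open>ladder_invariant\<close> is nonzero, as its first summand is \<open>Y 0\<close>.
\<close>

lemma span_split: "span (\<Union>n\<in>{..d}. split n) = UNIV"
proof -
  let ?W = "span (\<Union>n\<in>{..d}. low (n + 1) \<inter> high n)"
  obtain y where "y \<in> Y 0" "y \<noteq> 0"
    using Y_nonzero Y_eigenspace[of 0] subspace_eigenspace[OF As_linear] subspace_0 by blast
  then have "y \<in> low (0 + 1) \<inter> high 0"
    by (auto simp: low_def high_0 intro: span_base)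
  then have "y \<in> ?W" by (intro span_UN_base[of _ _ 0]) auto
  then have "?W = UNIV" using \<open>y \<noteq> 0\<close> ladder_invariant[of 1] by auto
  then show ?thesis by (simp add: split_def)
qed

text \<open>
  Each \<open>split m\<close> lies in \<open>low n\<close> when \<open>m < n\<close> and in \<open>high n\<close> when \<open>m \<ge> n\<close>.
\<close>

lemma low_plus_high:
  assumes "n \<le> Suc d"
  shows "\<exists>a\<in>low n. v - a \<in> high n"
proof -
  have "v \<in> span (\<Union>m\<in>{..<n} \<union> {n..d}. split m)"
    by (rule span_UN_mono[of _ _ "{..d}"]) (use span_split in auto)
  then obtain a b where a: "a \<in> span (\<Union>m<n. split m)" and b: "b \<in> span (\<Union>m\<in>{n..d}. split m)"
    and v: "v = a + b" by (rule span_UN_sum)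
  have "a \<in> low n" using a subspace_low
    by (rule span_UN_into) (auto simp: split_def elim: low_mono)
  moreover have "b \<in> high n" using b subspace_high
    by (rule span_UN_into) (auto simp: split_def elim: high_mono)
  ultimately show ?thesis using v by (intro bexI[of _ a]) auto
qed

lemma low_Suc_split:
  assumes "n \<le> d" "v \<in> low (Suc n)"
  shows "\<exists>u\<in>split n. v - u \<in> low n"
proof -
  obtain a where a: "a \<in> low n" "v - a \<in> high n" using low_plus_high[of n v] assms(1) by auto
  then have "v - a \<in> split n"
    using assms(2) low_mono[of a n "Suc n"] subspace_low by (auto simp: split_def subspace_diff)
  then show ?thesis using a by (intro bexI[of _ "v - a"]) auto
qed

lemma high_split:
  assumes "n \<le> d" "v \<in> high n"
  shows "\<exists>u\<in>split n. v - u \<in> high (Suc n)"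
proof -
  obtain a where a: "a \<in> low (Suc n)" "v - a \<in> high (Suc n)"
    using low_plus_high[of "Suc n" v] assms(1) by auto
  have "v - a \<in> high n" using high_mono[OF a(2)] by simp
  from subspace_diff[OF subspace_high assms(2) this] have "a \<in> high n" by simp
  then show ?thesis using a by (intro bexI[of _ a]) (auto simp: split_def)
qed

lemma low_in_span_split:
  "n \<le> Suc d \<Longrightarrow> v \<in> low n \<Longrightarrow> v \<in> span (\<Union>m<n. split m)"
proof (induction n arbitrary: v)
  case 0
  then show ?case by (simp add: low_0)
next
  case (Suc n)
  obtain u where u: "u \<in> split n" "v - u \<in> low n" using low_Suc_split Suc.prems by auto
  have "u \<in> span (\<Union>m<Suc n. split m)" using u by (intro span_UN_base[of _ _ n]) auto
  moreover have "v - u \<in> span (\<Union>m<Suc n. split m)"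
    using Suc.IH[of "v - u"] u Suc.prems by (auto elim: span_UN_mono)
  ultimately have "u + (v - u) \<in> span (\<Union>m<Suc n. split m)" by (rule span_add)
  then show ?case by simp
qed

text \<open>
  The summands before \<open>h\<close> lie in \<open>low h\<close> and those after \<open>h\<close> in \<open>high (Suc h)\<close>. The vanishing
  statement at \<open>Suc h\<close> disposes of the latter, then at \<open>h\<close> of \<open>x\<close>.
\<close>

lemma split_independent:
  assumes "h \<le> d" "x \<in> split h" "x \<in> span (\<Union>m\<in>{0..d} - {h}. split m)"
  shows "x = 0"
proof -
  have "x \<in> span (\<Union>m\<in>{..<h} \<union> {Suc h..d}. split m)"
    using assms(3) by (rule span_UN_mono) auto
  then obtain a b where a: "a \<in> span (\<Union>m<h. split m)"
    and b: "b \<in> span (\<Union>m\<in>{Suc h..d}. split m)" and x: "x = a + b" by (rule span_UN_sum)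
  have a: "a \<in> low h" using a subspace_low
    by (rule span_UN_into) (auto simp: split_def elim: low_mono)
  have b: "b \<in> high (Suc h)" using b subspace_high
    by (rule span_UN_into) (auto simp: split_def elim: high_mono)
  have "x - a \<in> low (Suc h)"
    using assms(2) a low_mono[of a h "Suc h"] subspace_low by (auto simp: split_def subspace_diff)
  then have "b = 0" using b x assms(1) by (intro low_Int_high[of b "Suc h"]) auto
  then show ?thesis using x a assms by (intro low_Int_high[of x h]) (auto simp: split_def)
qed

lemma split_proj_altdef:
  "split_proj d split h = proj_along (split h) (span (\<Union>m\<in>{0..d} - {h}. split m))"
  unfolding split_proj_def by (simp add: sum_subspaces_eq_span subspace_split)

lemma split_Int_others:
  assumes "h \<le> d" shows "split h \<inter> span (\<Union>m\<in>{0..d} - {h}. split m) = {0}"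
  using split_independent[OF assms] subspace_0[OF subspace_split] span_zero by auto

lemma split_proj_eq:
  assumes "h \<le> d" "w \<in> split h" "v - w \<in> span (\<Union>m\<in>{0..d} - {h}. split m)"
  shows "split_proj d split h v = w"
  unfolding split_proj_altdef using assms
  by (intro proj_along_eq split_Int_others subspace_split subspace_span)

lemma linear_split_proj:
  assumes "h \<le> d"
  shows "Vector_Spaces.linear scale scale (split_proj d split h)"
  unfolding split_proj_altdef
proof (rule linear_proj_along[OF subspace_split subspace_span split_Int_others[OF assms]])
  fix v
  have "v \<in> span (\<Union>m\<in>{h} \<union> ({0..d} - {h}). split m)"
    by (rule span_UN_mono[of _ _ "{..d}"]) (use span_split in auto)
  then obtain a b where a: "a \<in> span (\<Union>m\<in>{h}. split m)"
    and b: "b \<in> span (\<Union>m\<in>{0..d} - {h}. split m)" and v: "v = a + b" by (rule span_UN_sum)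
  have "a \<in> split h" using a subspace_split[of h] by simp (metis span_eq_iff)
  then show "\<exists>w\<in>split h. v - w \<in> span (\<Union>m\<in>{0..d} - {h}. split m)"
    using b v by (intro bexI[of _ a]) auto
qed

text \<open>
  Since \<open>split n\<close> is a complement of \<open>low n\<close> in \<open>low (Suc n)\<close>, its dimension depends only on the
  eigenspaces of \<open>A\<^sup>*\<close>. Being also a complement of \<open>high (Suc n)\<close> in \<open>high n\<close>, just as \<open>X n\<close> is, it
  has the dimension of \<open>X n\<close>.
\<close>

lemma dim_split_low: "n \<le> d \<Longrightarrow> dim (split n) + dim (low n) = dim (low (Suc n))"
  using low_Int_high[of _ n] subspace_0[OF subspace_split] subspace_0[OF subspace_low]
  by (intro dim_direct_sum subspace_split subspace_low low_Suc_split)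
    (auto simp: split_def elim: low_mono)

lemma dim_split_high: "n \<le> d \<Longrightarrow> dim (split n) + dim (high (Suc n)) = dim (high n)"
  using low_Int_high[of _ "Suc n"] subspace_0[OF subspace_split] subspace_0[OF subspace_high]
  by (intro dim_direct_sum subspace_split subspace_high high_split)
    (auto simp: split_def elim: high_mono)

lemma dim_X_high:
  assumes "n \<le> d"
  shows "dim (X n) + dim (high (Suc n)) = dim (high n)"
proof (rule dim_direct_sum)
  show "X n \<subseteq> high n" "high (Suc n) \<subseteq> high n"
    using assms by (auto simp: high_def intro: span_UN_base elim: span_UN_mono)
  show "X n \<inter> high (Suc n) = {0}"
    using eigenvector_not_in_span_others[of "{Suc n..d}" n] assms
      subspace_0[OF subspace_X] subspace_0[OF subspace_high] by (auto simp: high_def)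
  fix v assume "v \<in> high n"
  moreover have "{n..d} = {n} \<union> {Suc n..d}" using assms by auto
  ultimately have "v \<in> span (\<Union>j\<in>{n} \<union> {Suc n..d}. X j)" by (simp add: high_def)
  then obtain a b where a: "a \<in> span (\<Union>j\<in>{n}. X j)" and b: "b \<in> high (Suc n)"
    and v: "v = a + b" unfolding high_def by (rule span_UN_sum)
  have "a \<in> X n" using a subspace_X[OF assms] by simp (metis span_eq_iff)
  then show "\<exists>a\<in>X n. v - a \<in> high (Suc n)" using v b by (intro bexI[of _ a]) auto
qed (use assms subspace_X subspace_high in auto)

lemma dim_split: "n \<le> d \<Longrightarrow> dim (split n) = dim (X n)"
  using dim_split_high dim_X_high by fastforce

section \<open>The raising maps\<close>

text \<open>
  The operator \<open>\<tau>\<^sub>i\<^sub>j(A)\<close>, which carries \<open>split i\<close> into \<open>split j\<close>.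
\<close>

definition raise :: "nat \<Rightarrow> nat \<Rightarrow> 'v \<Rightarrow> 'v"
  where "raise i j v = poly_op scale (tau \<theta> i (int j)) A v"

definition K :: "nat \<Rightarrow> 'v set"
  where "K i = low (Suc i) \<inter> span (\<Union>j\<in>{i..d - i}. X j)"

lemma raise_same: "raise i i v = v"
  by (simp add: raise_def tau_def poly_op_1)

lemma raise_Suc:
  assumes "i \<le> j" shows "raise i (Suc j) v = A (raise i j v) - \<theta> j *s raise i j v"
proof -
  have "tau \<theta> i (int (Suc j)) = [:- \<theta> j, 1:] * tau \<theta> i (int j)"
    using assms by (simp add: tau_def nat_add_distrib atLeastLessThanSuc)
  then show ?thesis unfolding raise_def by (simp only: poly_op_linear_factor[OF A_linear])
qed

lemma raise_linear: "i \<le> j \<Longrightarrow> Vector_Spaces.linear scale scale (raise i j)"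
proof (induction j rule: dec_induct)
  case base
  show ?case by (rule linear_intro) (simp_all add: raise_same)
next
  case (step j)
  then show ?case
    by (intro linear_intro)
      (simp_all add: raise_Suc linear_map_add[OF step.IH] linear_map_scale[OF step.IH]
        A_add A_scale algebra_simps)
qed

lemma raise_raise: "j \<le> m \<Longrightarrow> i \<le> j \<Longrightarrow> raise j m (raise i j v) = raise i m v"
proof (induction m rule: dec_induct)
  case (step m)
  then show ?case by (simp add: raise_Suc)
qed (simp add: raise_same)

lemma raise_high: "i \<le> j \<Longrightarrow> v \<in> high i \<Longrightarrow> raise i j v \<in> high j"
  by (induction j rule: dec_induct) (simp_all add: raise_same raise_Suc A_raise)

lemma raise_low: "i \<le> j \<Longrightarrow> j \<le> d \<Longrightarrow> v \<in> low (Suc i) \<Longrightarrow> raise i j v \<in> low (Suc j)"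
proof (induction j rule: dec_induct)
  case (step j)
  then have "raise i j v \<in> low (Suc j)" by simp
  then show ?case
    using step A_low[of "raise i j v" "Suc j"] low_mono[of "raise i j v" "Suc j" "Suc (Suc j)"]
    by (auto simp: raise_Suc intro!: subspace_diff subspace_scale subspace_low)
qed (simp add: raise_same)

lemma raise_split: "i \<le> j \<Longrightarrow> j \<le> d \<Longrightarrow> v \<in> split i \<Longrightarrow> raise i j v \<in> split j"
  by (simp add: split_def raise_high raise_low)

lemma raise_invariant:
  assumes "i \<le> j" "subspace W" "\<And>w. w \<in> W \<Longrightarrow> A w \<in> W" "v \<in> W"
  shows "raise i j v \<in> W"
  using assms(1)
  by (induction j rule: dec_induct)
    (simp_all add: raise_same raise_Suc assms subspace_diff subspace_scale)

text \<open>
  On \<open>high j\<close> none of the factors \<open>A - \<theta> h\<close> with \<open>h < j\<close> has a kernel.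
\<close>

lemma raise_eq_0_on_high: "i \<le> j \<Longrightarrow> v \<in> high j \<Longrightarrow> raise i j v = 0 \<Longrightarrow> v = 0"
proof (induction j arbitrary: v rule: dec_induct)
  case base
  then show ?case by (simp add: raise_same)
next
  case (step j)
  let ?w = "raise i j v"
  have v: "v \<in> high j" using step.prems(1) by (rule high_mono) simp
  have w: "?w \<in> high (Suc j)"
    using step.hyps(1) subspace_high A_high step.prems(1) by (rule raise_invariant)
  have "?w = 0"
  proof (cases "j \<le> d")
    case True
    have "A ?w = \<theta> j *s ?w" using step by (simp add: raise_Suc)
    then have "?w \<in> X j" using True by (simp add: X_eigenspace eigenspace_def)
    then show ?thesis
      using w True eigenvector_not_in_span_others[of "{Suc j..d}" j ?w] by (auto simp: high_def)
  next
    case False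
    then show ?thesis using high_mono[OF w, of "Suc d"] by (simp add: high_Suc_d)
  qed
  then show ?case using step.IH v by blast
qed

text \<open>
  Split \<open>v\<close> at the index \<open>j\<close>: the product kills the part below \<open>j\<close> and is injective on the part
  above, which therefore vanishes.
\<close>

lemma raise_kernel:
  assumes "i \<le> j" "j \<le> Suc d" "v \<in> high i" "raise i j v = 0"
  shows "v \<in> span (\<Union>h\<in>{i..<j}. X h)"
proof -
  have "v \<in> span (\<Union>h\<in>{i..<j} \<union> {j..d}. X h)"
    using assms(3) unfolding high_def by (rule span_UN_mono) auto
  then obtain a b where a: "a \<in> span (\<Union>h\<in>{i..<j}. X h)" and b: "b \<in> high j" and v: "v = a + b"
    unfolding high_def by (rule span_UN_sum)
  have "raise i j a \<in> {0}"
    using raise_linear[OF assms(1)] a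
  proof (rule linear_span_UN_into)
    fix h x assume h: "h \<in> {i..<j}" and x: "x \<in> X h"
    have "raise i h x \<in> X h"
      using h x assms(2) A_X[of h] subspace_X[of h]
      by (intro raise_invariant) (auto simp: subspace_scale)
    then have "raise i (Suc h) x = 0"
      using h assms(2) by (simp add: raise_Suc A_X)
    then have "raise (Suc h) j (raise i (Suc h) x) = 0"
      using h linear_map_0[OF raise_linear[of "Suc h" j]] by simp
    then show "raise i j x \<in> {0}" using h by (simp add: raise_raise)
  qed simp
  then have "raise i j b = 0"
    using assms(4) by (simp add: v linear_map_add[OF raise_linear[OF assms(1)]])
  then have "b = 0" using b raise_eq_0_on_high[OF assms(1)] by blast
  then show ?thesis using a v by simp
qed

section \<open>Reversing the ordering of the eigenspaces of A\<close>

lemma span_UN_reverse: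
  assumes "v \<in> span (\<Union>j\<in>J. X j)" "\<And>j. j \<in> J \<Longrightarrow> j \<le> d \<and> d - j \<in> J'"
  shows "v \<in> span (\<Union>j\<in>J'. X (d - j))"
  using assms(1)
proof (rule span_UN_into)
  fix j x assume "j \<in> J" "x \<in> X j"
  then show "x \<in> span (\<Union>j\<in>J'. X (d - j))"
    using assms(2)[of j] by (intro span_UN_base[of x "\<lambda>j. X (d - j)" "d - j"]) auto
qed simp

lemma td_flags_reverse: "td_flags scale Basis d A As (\<lambda>i. X (d - i)) Y (\<lambda>i. \<theta> (d - i)) \<theta>s"
proof (intro td_flags.intro td_flags_axioms.intro finite_dimensional_vector_space_axioms)
  show "inj_on (\<lambda>i. \<theta> (d - i)) {..d}"
    by (rule inj_onI) (use inj_onD[OF \<theta>_inj] in force)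
  have "v \<in> span (\<Union>i\<le>d. X (d - i))" for v
    by (rule span_UN_reverse[of _ "{..d}"]) (use X_span in auto)
  then show "span (\<Union>i\<le>d. X (d - i)) = UNIV" by blast
  show "As x \<in> span (\<Union>j\<in>{j. j \<le> d \<and> i \<le> j + 1 \<and> j \<le> i + 1}. X (d - j))"
    if "i \<le> d" "x \<in> X (d - i)" for i x
    by (rule span_UN_reverse[OF As_X[OF _ that(2)]]) (use that in auto)
qed (use A_linear As_linear X_eigenspace Y_eigenspace X_nonzero Y_nonzero A_Y irreducible
    in auto)

text \<open>
  In the notation of the introduction, \<open>rev.split j\<close> is \<open>U\<^sub>j\<^sup>\<Down>\<close> and \<open>rev.raise i j\<close> is
  \<open>\<eta>\<^sub>i\<^sub>j(A)\<close>. The flag \<open>low\<close> is shared by both orderings.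
\<close>

interpretation rev: td_flags scale Basis d A As "\<lambda>i. X (d - i)" Y "\<lambda>i. \<theta> (d - i)" \<theta>s
  by (rule td_flags_reverse)

lemma rev_high:
  assumes "n \<le> d" shows "rev.high n = span (\<Union>j\<in>{0..d - n}. X j)"
proof -
  have "(\<lambda>j. d - j) ` {n..d} = {0..d - n}"
  proof safe
    fix j assume "j \<in> {0..d - n}"
    then show "j \<in> (\<lambda>j. d - j) ` {n..d}" using assms by (intro image_eqI[of _ _ "d - j"]) auto
  qed auto
  then have "(\<Union>j\<in>{n..d}. X (d - j)) = (\<Union>j\<in>{0..d - n}. X j)" by (metis image_image)
  then show ?thesis by (simp add: rev.high_def)
qed

text \<open>
  The spaces with index \<open>n\<close> of both split decompositions are complements of \<open>low n\<close> in
  \<open>low (Suc n)\<close>; for the second decomposition the dimension is that of \<open>X (d - n)\<close>.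
\<close>

lemma dim_split_symmetric:
  assumes "n \<le> d" shows "dim (split n) = dim (split (d - n))"
proof -
  have "dim (split n) = dim (rev.split n)"
    using dim_split_low[OF assms] rev.dim_split_low[OF assms] by simp
  also have "\<dots> = dim (X (d - n))" by (rule rev.dim_split[OF assms])
  also have "\<dots> = dim (split (d - n))" by (simp add: dim_split)
  finally show ?thesis .
qed

text \<open>
  The kernel consists of vectors of \<open>low (Suc i)\<close> whose components in \<open>X (d - i), \<dots>, X d\<close> are
  zero. For the reversed ordering this puts them into \<open>rev.high (Suc i)\<close>, so they vanish.
  Surjectivity follows by comparing dimensions.
\<close>

lemma raise_split_onto:
  assumes "2 * i \<le> d"
  shows "raise i (d - i) ` split i = split (d - i)"
proof (rule subspace_dim_equal)
  have le: "i \<le> d - i" using assms by simp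
  note lin = raise_linear[OF le]
  interpret pair: finite_dimensional_vector_space_pair_1 scale Basis scale ..
  have inj: "v = 0" if v: "v \<in> split i" "raise i (d - i) v = 0" for v
  proof -
    have "v \<in> span (\<Union>h\<in>{i..<d - i}. X h)"
      using raise_kernel[OF le] v by (simp add: split_def)
    then have "v \<in> rev.high (Suc i)"
      unfolding rev.high_def by (rule span_UN_reverse) auto
    then show ?thesis using rev.low_Int_high[of v "Suc i"] v assms by (simp add: split_def)
  qed
  have "inj_on (raise i (d - i)) (split i)"
  proof (intro inj_onI)
    fix u v assume "u \<in> split i" "v \<in> split i" "raise i (d - i) u = raise i (d - i) v"
    then have "u - v \<in> split i" "raise i (d - i) (u - v) = 0"
      by (simp_all add: subspace_diff subspace_split linear_map_diff[OF lin])
    then have "u - v = 0" by (rule inj)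
    then show "u = v" by simp
  qed
  then have "inj_on (raise i (d - i)) (span (split i))"
    by (simp only: span_eq_iff[THEN iffD2, OF subspace_split])
  then have "dim (raise i (d - i) ` split i) = dim (split i)"
    by (rule pair.dim_image_eq[OF lin])
  then show "dim (split (d - i)) \<le> dim (raise i (d - i) ` split i)"
    using dim_split_symmetric[of i] assms by simp
  show "subspace (raise i (d - i) ` split i)"
    using module_hom.subspace_image[OF _ subspace_split] lin
    by (simp add: module_hom_iff_linear)
  show "raise i (d - i) ` split i \<subseteq> split (d - i)"
    using raise_split[OF le] by auto
qed (rule subspace_split)

text \<open>
  In the step, \<open>u\<close> is corrected by the image of a vector \<open>w\<close> of \<open>split j\<close> chosen so that the
  difference is killed on its way to \<open>split (d - j)\<close>. By \<open>raise_kernel\<close> the difference then has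
  no components beyond \<open>X (d - Suc j)\<close>, which is what distinguishes \<open>K (Suc j)\<close> inside
  \<open>split (Suc j)\<close>.
\<close>

lemma split_in_span_raise_K:
  "2 * j \<le> d \<Longrightarrow> u \<in> split j \<Longrightarrow> u \<in> span (\<Union>i\<in>{..j}. raise i j ` K i)"
proof (induction j arbitrary: u)
  case 0
  then have "u \<in> K 0" by (simp add: K_def split_def high_def)
  then have "u \<in> raise 0 0 ` K 0" by (intro image_eqI[of _ _ u]) (simp_all only: raise_same)
  then show ?case by (intro span_UN_base[of u _ 0]) simp_all
next
  case (Suc j)
  let ?m = "d - j" and ?S = "span (\<Union>i\<in>{..Suc j}. raise i (Suc j) ` K i)"
  have le: "Suc j \<le> ?m" using Suc.prems by simp
  \<comment> \<open>By surjectivity the image of \<open>u\<close> is already reached from \<open>split j\<close>.\<close>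
  have "raise (Suc j) ?m u \<in> raise j ?m ` split j"
    using raise_split[OF le] Suc.prems raise_split_onto[of j] by simp
  then obtain w where w: "w \<in> split j" and eq: "raise (Suc j) ?m u = raise j ?m w" by auto
  let ?k = "u - raise j (Suc j) w"
  have k: "?k \<in> split (Suc j)"
    using Suc.prems raise_split[OF _ _ w] by (intro subspace_diff subspace_split) auto
  have "raise (Suc j) ?m ?k = 0"
    using le by (simp add: linear_map_diff[OF raise_linear[OF le]] raise_raise eq)
  then have "?k \<in> span (\<Union>h\<in>{Suc j..<?m}. X h)"
    using raise_kernel[OF le] k by (simp add: split_def)
  moreover have "{Suc j..<?m} = {Suc j..d - Suc j}" using Suc.prems by auto
  ultimately have "?k \<in> K (Suc j)" using k by (simp add: K_def split_def)
  then have "?k \<in> ?S"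
    by (intro span_UN_base[of _ _ "Suc j"] image_eqI[of _ _ ?k]) (simp_all add: raise_same)
  moreover have "raise j (Suc j) w \<in> ?S"
  proof (rule linear_span_UN_into[OF raise_linear Suc.IH[OF _ w]])
    fix i x assume "i \<in> {..j}" "x \<in> raise i j ` K i"
    then show "raise j (Suc j) x \<in> ?S"
      by (intro span_UN_base[of _ _ i]) (auto simp: raise_raise)
  qed (use Suc.prems in auto)
  ultimately have "?k + raise j (Suc j) w \<in> ?S" by (rule span_add)
  then show ?case by simp
qed

text \<open>
  The first half of the split decomposition is covered by \<open>split_in_span_raise_K\<close>; the second
  half is the image of the first under \<open>raise_split_onto\<close>.
\<close>

lemma span_raise_K:
  "span {raise i j v |i j v. 2 * i \<le> d \<and> i \<le> j \<and> j \<le> d - i \<and> v \<in> K i} = UNIV"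
  (is "span ?R = UNIV")
proof -
  have lower: "u \<in> span ?R" if "2 * j \<le> d" "u \<in> split j" for j u
    using split_in_span_raise_K[OF that]
  proof (rule span_UN_into)
    fix i x assume "i \<in> {..j}" "x \<in> raise i j ` K i"
    then obtain v where h: "i \<le> j" "v \<in> K i" "x = raise i j v" by auto
    moreover have "2 * i \<le> d" "j \<le> d - i" using h(1) that(1) by auto
    ultimately show "x \<in> span ?R" by (intro span_base) blast
  qed simp
  have "u \<in> span ?R" if "j \<le> d" "u \<in> split j" for j u
  proof (cases "2 * j \<le> d")
    case False
    let ?i = "d - j"
    have i: "2 * ?i \<le> d" "d - ?i = j" "?i \<le> j" using False that(1) by auto
    then have "u \<in> raise ?i j ` split ?i" using that(2) raise_split_onto[of ?i] by simp
    then obtain w where w: "w \<in> split ?i" and u: "u = raise ?i j w" by blast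
    show ?thesis unfolding u
    proof (rule linear_span_UN_into[OF raise_linear split_in_span_raise_K[OF _ w]])
      fix h x assume "h \<in> {..?i}" "x \<in> raise h ?i ` K h"
      then obtain v where h: "h \<le> ?i" and v: "v \<in> K h" and x: "x = raise h ?i v" by auto
      have "raise ?i j x = raise h j v" using i h by (simp add: x raise_raise)
      moreover have "2 * h \<le> d" "h \<le> j" "j \<le> d - h" using i h that(1) by auto
      ultimately show "raise ?i j x \<in> span ?R" using v by (intro span_base) blast
    qed (use i in auto)
  next
    case True
    then show ?thesis using lower that(2) by blast
  qed
  then have "span (\<Union>j\<in>{..d}. split j) \<subseteq> span ?R"
    by (intro span_minimal subspace_span UN_least subsetI) simp
  then show ?thesis unfolding span_split by blast
qed

section \<open>The maps Delta and Psi on the spanning vectors\<close>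

definition delta :: "'v \<Rightarrow> 'v"
  where "delta v = (\<Sum>h=0..d. split_proj d rev.split h (split_proj d split h v))"

lemma linear_delta: "Vector_Spaces.linear scale scale delta"
proof (rule linear_intro)
  show "delta (x + y) = delta x + delta y" for x y
    unfolding delta_def sum.distrib[symmetric]
    by (intro sum.cong)
      (simp_all add: linear_map_add[OF linear_split_proj] linear_map_add[OF rev.linear_split_proj])
  show "delta (c *s x) = c *s delta x" for c x
    unfolding delta_def scale_sum_right
    by (intro sum.cong)
      (simp_all add: linear_map_scale[OF linear_split_proj] linear_map_scale[OF rev.linear_split_proj])
qed

text \<open>
  The operator \<open>\<tau>\<^sub>i\<^sub>,\<^sub>j\<^sub>-\<^sub>1(A)\<close>, which is zero for \<open>j = i\<close>.
\<close>

definition raise_pred :: "nat \<Rightarrow> nat \<Rightarrow> 'v \<Rightarrow> 'v"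
  where "raise_pred i j v = poly_op scale (tau \<theta> i (int j - 1)) A v"

lemma raise_pred_same: "raise_pred i i v = 0"
  by (simp add: raise_pred_def tau_def poly_op_0)

lemma raise_pred_Suc: "raise_pred i (Suc j) v = raise i j v"
  by (simp add: raise_pred_def raise_def)

lemma raise_pred_low:
  assumes "i \<le> j" "j \<le> Suc d" "v \<in> low (Suc i)" shows "raise_pred i j v \<in> low j"
proof (cases "i = j")
  case True
  then show ?thesis using subspace_0[OF subspace_low] by (simp add: raise_pred_same)
next
  case False
  then obtain k where "j = Suc k" "i \<le> k" using assms(1) by (cases j) auto
  then show ?thesis using raise_low[of i k v] assms by (simp add: raise_pred_Suc)
qed

text \<open>
  The polynomials behind \<open>rev.raise i j\<close> and \<open>raise i j\<close> are monic of degree \<open>j - i\<close>. Their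
  difference has smaller degree, and its coefficient in degree \<open>j - i - 1\<close> is the difference of
  the sums of the roots. As \<open>A\<close> moves the end of \<open>low\<close>
  by at most one step, the terms of lower degree end up in \<open>low (j - 1)\<close>. For \<open>j = 0\<close> this set is
  \<open>low 0\<close>, in accordance with an error of zero.
\<close>

lemma rev_raise_expansion:
  assumes "i \<le> j" "j \<le> d" "v \<in> low (Suc i)"
  shows "rev.raise i j v - raise i j v
    - (\<Sum>h\<in>{i..<j}. \<theta> h - \<theta> (d - h)) *s raise_pred i j v \<in> low (j - 1)"
  using assms(1,2)
proof (induction j rule: dec_induct)
  case base
  then show ?case using subspace_0[OF subspace_low]
    by (simp add: raise_same rev.raise_same)
next
  case (step j)
  let ?c = "\<Sum>h\<in>{i..<j}. \<theta> h - \<theta> (d - h)" and ?t = "\<theta> (d - j)"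
  let ?r = "raise i j v" and ?p = "raise_pred i j v"
  let ?y = "rev.raise i j v - ?r - ?c *s ?p"
  have y: "?y \<in> low (j - 1)" using step by simp
  have Ay: "A ?y - ?t *s ?y \<in> low j"
  proof (cases j)
    case 0
    then have "?y = 0" using y by (simp add: low_0)
    then show ?thesis by (simp add: A_0 subspace_0[OF subspace_low])
  next
    case (Suc k)
    have "A ?y \<in> low j" "?y \<in> low j"
      using y step.prems A_low[of ?y k] low_mono[of ?y k j] by (simp_all add: Suc)
    then show ?thesis
      by (rule subspace_diff[OF subspace_low _ subspace_scale[OF subspace_low]])
  qed
  \<comment> \<open>For \<open>j = i\<close> both \<open>?c\<close> and \<open>?p\<close> are zero; otherwise \<open>?r\<close> arises from \<open>?p\<close> by one more factor.\<close>
  have p: "?c *s (A ?p - ?t *s ?p - ?r) \<in> low j"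
  proof (cases "i = j")
    case True
    then show ?thesis by (simp add: subspace_0[OF subspace_low])
  next
    case False
    then obtain k where k: "j = Suc k" "i \<le> k" using step.hyps by (cases j) auto
    have "A ?p - ?t *s ?p - ?r = (\<theta> k - ?t) *s ?p"
      using k by (simp add: raise_pred_Suc raise_Suc scale_left_diff_distrib)
    moreover have "?p \<in> low j" using step assms by (intro raise_pred_low) auto
    ultimately show ?thesis by (simp add: subspace_scale subspace_low)
  qed
  have "rev.raise i (Suc j) v - raise i (Suc j) v
      - (\<Sum>h\<in>{i..<Suc j}. \<theta> h - \<theta> (d - h)) *s raise_pred i (Suc j) v
    = (A ?y - ?t *s ?y) + ?c *s (A ?p - ?t *s ?p - ?r)"
    using step.hyps
    by (simp add: raise_Suc rev.raise_Suc raise_pred_Suc atLeastLessThanSuc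
        A_add A_diff A_scale algebra_simps)
  also have "\<dots> \<in> low j" using Ay p by (rule subspace_add[OF subspace_low])
  finally show ?case by simp
qed

text \<open>
  The first projections single out the index \<open>j\<close>. The vector \<open>rev.raise i j v\<close> lies in
  \<open>rev.split j\<close> and differs from \<open>raise i j v\<close> by an element of \<open>low j\<close>, which is the span of the
  spaces \<open>rev.split m\<close> with \<open>m < j\<close>; so it is the projection of \<open>raise i j v\<close>.
\<close>

lemma delta_raise_K:
  assumes "2 * i \<le> d" "i \<le> j" "j \<le> d - i" "v \<in> K i"
  shows "delta (raise i j v) = rev.raise i j v"
proof -
  have j: "j \<le> d" using assms by simp
  have v: "v \<in> low (Suc i)" "v \<in> high i" "v \<in> rev.high i"
  proof -
    show "v \<in> low (Suc i)" using assms(4) by (simp add: K_def)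
    have *: "v \<in> span (\<Union>j\<in>{i..d - i}. X j)" using assms(4) by (simp add: K_def)
    show "v \<in> high i" using * unfolding high_def by (rule span_UN_mono) auto
    show "v \<in> rev.high i" using * unfolding rev.high_def by (rule span_UN_reverse) auto
  qed
  have r: "raise i j v \<in> split j" and r': "rev.raise i j v \<in> rev.split j"
    using raise_split[OF assms(2) j] rev.raise_split[OF assms(2) j] v
    by (simp_all add: split_def rev.split_def)
  let ?e = "rev.raise i j v - raise i j v" and ?c = "\<Sum>h\<in>{i..<j}. \<theta> h - \<theta> (d - h)"
  have "(?e - ?c *s raise_pred i j v) + ?c *s raise_pred i j v \<in> low j"
    using rev_raise_expansion[OF assms(2) j v(1)] raise_pred_low[OF assms(2) _ v(1)] j
    by (intro subspace_add subspace_scale subspace_low) (auto elim: low_mono)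
  then have "- ?e \<in> low j" using subspace_neg[OF subspace_low, of ?e j] by simp
  then have "raise i j v - rev.raise i j v \<in> span (\<Union>m<j. rev.split m)"
    using rev.low_in_span_split[of j] j by simp
  then have "raise i j v - rev.raise i j v \<in> span (\<Union>m\<in>{0..d} - {j}. rev.split m)"
    by (rule span_UN_mono) (use j in auto)
  then have proj': "split_proj d rev.split j (raise i j v) = rev.raise i j v"
    by (intro rev.split_proj_eq j r')
  have "split_proj d split j (raise i j v) = raise i j v"
    by (rule split_proj_eq[OF j r]) (simp add: span_zero)
  moreover have "split_proj d split h (raise i j v) = 0" if "h \<le> d" "h \<noteq> j" for h
    using that r j subspace_0[OF subspace_split]
    by (intro split_proj_eq) (auto intro: span_UN_base[of _ _ j])
  ultimately have "split_proj d rev.split h (split_proj d split h (raise i j v))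
      = (if h = j then rev.raise i j v else 0)" if "h \<in> {0..d}" for h
    using that proj' linear_map_0[OF rev.linear_split_proj[of h]] by auto
  then show ?thesis using j by (simp add: delta_def)
qed

text \<open>
  The difference of both sides lies in \<open>low (j - 1)\<close> by the condition on the \<open>Y i\<close>, because
  \<open>delta\<close> contributes the right-hand side up to \<open>low (j - 1)\<close>, and in \<open>high (j - 1)\<close> by the
  condition on the \<open>X i\<close>; so it vanishes.
\<close>

lemma psi_formula_on_raise_K:
  assumes P: "Vector_Spaces.linear scale scale P"
    and PX: "\<And>i x. i \<le> d \<Longrightarrow> x \<in> X i \<Longrightarrow>
      P x \<in> span (\<Union>j\<in>{j. j \<le> d \<and> i \<le> j + 1 \<and> j \<le> i + 1}. X j)"
    and PY: "\<And>i y. i \<le> d \<Longrightarrow> y \<in> Y i \<Longrightarrow> P y - c *s (delta y - y) \<in> low (i - 1)"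
    and ij: "2 * i \<le> d" "i \<le> j" "j \<le> d - i" "v \<in> K i"
  shows "P (raise i j v) = (c * (\<Sum>h\<in>{i..<j}. \<theta> h - \<theta> (d - h))) *s raise_pred i j v"
proof -
  let ?x = "raise i j v" and ?a = "\<Sum>h\<in>{i..<j}. \<theta> h - \<theta> (d - h)"
  let ?z = "P ?x - (c * ?a) *s raise_pred i j v"
  have j: "j \<le> d" using ij by simp
  have v: "v \<in> low (Suc i)" "v \<in> high i"
    using ij(4) span_UN_mono[of v X "{i..d - i}" "{i..d}"] by (auto simp: K_def high_def)
  have x: "?x \<in> low (Suc j)" "?x \<in> high j" using raise_low raise_high v ij j by auto
  have "Vector_Spaces.linear scale scale (\<lambda>y. P y - c *s (delta y - y))"
    by (rule linear_intro)
      (simp_all add: linear_map_add[OF P] linear_map_scale[OF P] linear_map_add[OF linear_delta]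
        linear_map_scale[OF linear_delta] algebra_simps)
  then have "P ?x - c *s (delta ?x - ?x) \<in> low (j - 1)"
    using x(1)[unfolded low_def] subspace_low
  proof (rule linear_span_UN_into)
    fix h y assume "h \<in> {..<Suc j}" "y \<in> Y h"
    then show "P y - c *s (delta y - y) \<in> low (j - 1)"
      using PY[of h y] low_mono[of _ "h - 1" "j - 1"] j by auto
  qed
  moreover have "c *s (delta ?x - ?x - ?a *s raise_pred i j v) \<in> low (j - 1)"
    using rev_raise_expansion[OF ij(2) j v(1)] delta_raise_K[OF ij]
    by (simp add: subspace_scale subspace_low)
  ultimately have "(P ?x - c *s (delta ?x - ?x)) + c *s (delta ?x - ?x - ?a *s raise_pred i j v)
      \<in> low (j - 1)"
    by (rule subspace_add[OF subspace_low])
  then have low: "?z \<in> low (j - 1)" by (simp add: algebra_simps)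
  have "P ?x \<in> high (j - 1)"
    using P x(2)[unfolded high_def] subspace_high
  proof (rule linear_span_UN_into)
    fix h y assume h: "h \<in> {j..d}" "y \<in> X h"
    then show "P y \<in> high (j - 1)"
      unfolding high_def by (intro span_UN_mono[OF PX[of h y]]) auto
  qed
  moreover have "raise_pred i j v \<in> high (j - 1)"
  proof (cases "i = j")
    case True
    then show ?thesis by (simp add: raise_pred_same subspace_0 subspace_high)
  next
    case False
    then obtain k where "j = Suc k" "i \<le> k" using ij(2) by (cases j) auto
    then show ?thesis using raise_high[of i k v] v by (simp add: raise_pred_Suc)
  qed
  ultimately have "?z \<in> high (j - 1)" by (intro subspace_diff subspace_scale subspace_high)
  with low have "?z = 0" using j by (intro low_Int_high[of ?z "j - 1"]) auto
  then show ?thesis by simp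
qed

end

section \<open>The uniqueness statement\<close>

text \<open>
  The ranges of the idempotents are the eigenspaces, each with the single eigenvalue \<open>theta\<close>
  because eigenspaces contain nonzero vectors.
\<close>

lemma td_flags_of_td_system:
  fixes s :: "'k::field \<Rightarrow> 'v::ab_group_add \<Rightarrow> 'v"
  assumes "finite_dimensional_vector_space s Basis" "td_system s d A E As Es"
  shows "td_flags s Basis d A As (\<lambda>i. range (E i)) (\<lambda>i. range (Es i)) (theta s A E) (theta s As Es)"
proof -
  interpret finite_dimensional_vector_space s Basis by fact
  have td: "td_pair s A As" "standard_ordering s d A As (\<lambda>i. range (E i))"
    "standard_ordering s d As A (\<lambda>i. range (Es i))"
    using assms(2) by (auto simp: td_system_def)
  have lin: "Vector_Spaces.linear s s A" "Vector_Spaces.linear s s As"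
    and diag: "diagonalizable s A" using td(1) by (auto simp: td_pair_def)
  have eigen: "range (F i) = eigenspace s B (theta s B F i)" "range (F i) \<noteq> {0}"
    if B: "Vector_Spaces.linear s s B" and ord: "standard_ordering s d B C (\<lambda>i. range (F i))"
      and i: "i \<le> d" for B C F i
  proof -
    have "range (F i) \<in> eigenspaces s B"
      using ord i by (auto simp: standard_ordering_def bij_betw_def)
    then obtain t where t: "range (F i) = eigenspace s B t" and nz: "eigenspace s B t \<noteq> {0}"
      by (auto simp: eigenspaces_def)
    then obtain x where x: "x \<in> eigenspace s B t" "x \<noteq> 0"
      using subspace_0[OF subspace_eigenspace[OF B]] by blast
    have "theta s B F i = t"
      unfolding theta_def
    proof (rule the_equality)
      fix u assume "\<forall>v\<in>range (F i). B v = s u v"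
      then have "B x = s u x" using x(1) t by blast
      moreover have "B x = s t x" using x(1) by (simp add: eigenspace_def)
      ultimately have "s u x = s t x" by metis
      then show "u = t" using x(2) scale_cancel_right by blast
    qed (simp add: t eigenspace_def)
    then show "range (F i) = eigenspace s B (theta s B F i)" "range (F i) \<noteq> {0}"
      using t nz by auto
  qed
  have X_span: "span (\<Union>i\<le>d. range (E i)) = UNIV"
    using diag td(2) by (simp add: diagonalizable_def standard_ordering_def bij_betw_def)
  have tridiagonal: "C x \<in> span (\<Union>j\<in>{j. j \<le> d \<and> i \<le> j + 1 \<and> j \<le> i + 1}. range (F j))"
    if B: "Vector_Spaces.linear s s B" and ord: "standard_ordering s d B C (\<lambda>i. range (F i))"
      and i: "i \<le> d" "x \<in> range (F i)" for B C and F :: "nat \<Rightarrow> 'v \<Rightarrow> 'v" and i x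
  proof -
    have "C x \<in> neighbour_sum d (\<lambda>i. range (F i)) i"
      using ord i by (auto simp: standard_ordering_def)
    moreover have "subspace (range (F j))" if "j \<le> d" for j
      using eigen(1)[OF B ord that] subspace_eigenspace[OF B] by simp
    then have "neighbour_sum d (\<lambda>i. range (F i)) i
        = span (\<Union>j\<in>{j. j \<le> d \<and> i \<le> j + 1 \<and> j \<le> i + 1}. range (F j))"
      unfolding neighbour_sum_def by (intro sum_subspaces_eq_span) auto
    ultimately show ?thesis by simp
  qed
  have "inj_on (theta s A E) {..d}"
  proof (rule inj_onI)
    fix i j assume ij: "i \<in> {..d}" "j \<in> {..d}" "theta s A E i = theta s A E j"
    then have "range (E i) = range (E j)" using eigen(1)[OF lin(1) td(2)] by simp
    then show "i = j" using td(2) ij by (auto simp: standard_ordering_def bij_betw_def inj_on_def)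
  qed
  then show ?thesis
    using lin eigen[OF lin(1) td(2)] eigen[OF lin(2) td(3)] X_span
      tridiagonal[OF lin(1) td(2)] tridiagonal[OF lin(2) td(3)] td(1)
    by (intro td_flags.intro td_flags_axioms.intro finite_dimensional_vector_space_axioms)
      (auto simp: td_pair_def)
qed

theorem lemma16p3:
  fixes s :: "'k::field \<Rightarrow> 'v::ab_group_add \<Rightarrow> 'v"
    and Basis :: "'v set"
    and d :: nat
    and A As \<Psi>' :: "'v \<Rightarrow> 'v"
    and E Es :: "nat \<Rightarrow> 'v \<Rightarrow> 'v"
  assumes "finite_dimensional_vector_space s Basis"
    and "vector_space.dim s (UNIV :: 'v set) > 0"
    and "td_system s d A E As Es"
    and "d \<ge> 1"
    and "Vector_Spaces.linear s s \<Psi>'"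
    and "\<And>i. i \<le> d \<Longrightarrow>
      \<Psi>' ` range (E i) \<subseteq> neighbour_sum d (\<lambda>j. range (E j)) i"
    and "\<And>i. i \<le> d \<Longrightarrow>
      (\<lambda>v. \<Psi>' v - s (1 / (theta s A E 0 - theta s A E d)) (Delta d E Es v - v)) ` range (Es i)
        \<subseteq> (\<Sum>j | j + 2 \<le> i. range (Es j))"
  shows "\<Psi>' = Psi s d A E Es"
proof -
  let ?X = "\<lambda>i. range (E i)" and ?Y = "\<lambda>i. range (Es i)" and ?\<theta> = "theta s A E"
  interpret td_flags s Basis d A As ?X ?Y ?\<theta> "theta s As Es"
    using assms(1,3) by (rule td_flags_of_td_system)
  interpret rev: td_flags s Basis d A As "\<lambda>i. ?X (d - i)" ?Y "\<lambda>i. ?\<theta> (d - i)" "theta s As Es"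
    by (rule td_flags_reverse)
  have subY: "subspace (?Y i)" if "i \<le> d" for i
    using Y_eigenspace[OF that] subspace_eigenspace[OF As_linear] by simp
  have sumX: "(\<Sum>j\<in>J. ?X j) = span (\<Union>j\<in>J. ?X j)"
    and sumY: "(\<Sum>j\<in>J. ?Y j) = span (\<Union>j\<in>J. ?Y j)" if "J \<subseteq> {..d}" for J
    using that finite_subset[OF that] subspace_X subY
    by (auto intro!: sum_subspaces_eq_span)
  have lowY: "(\<Sum>j\<in>{0..i}. ?Y j) = low (Suc i)" if "i \<le> d" for i
    using that sumY[of "{0..i}"] by (auto simp: low_def lessThan_Suc_atMost atLeast0AtMost)
  have split1: "split1 d E Es i = split i" if "i \<le> d" for i
    using that sumX[of "{i..d}"] by (auto simp: split1_def split_def lowY high_def)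
  have split2: "split2 d E Es i = rev.split i" if "i \<le> d" for i
    using that sumX[of "{0..d - i}"] by (auto simp: split2_def rev.split_def lowY rev_high)
  have Kspace: "Kspace d E Es i = K i" if "i \<le> d" for i
    using that sumX[of "{i..d - i}"] by (auto simp: Kspace_def K_def lowY)
  have proj: "split_proj d U h = split_proj d U' h"
    if "\<And>i. i \<le> d \<Longrightarrow> U i = U' i" "h \<le> d" for U U' :: "nat \<Rightarrow> 'v set" and h
  proof -
    have "(\<Sum>j\<in>{0..d} - {h}. U j) = (\<Sum>j\<in>{0..d} - {h}. U' j)"
      by (rule sum.cong) (auto simp: that)
    then show ?thesis using that by (simp add: split_proj_def)
  qed
  have Delta: "Delta d E Es v = delta v" for v
    unfolding Delta_def delta_def
  proof (rule sum.cong)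
    fix h assume "h \<in> {0..d}"
    then have "h \<le> d" by simp
    then show "split_proj d (split2 d E Es) h (split_proj d (split1 d E Es) h v)
        = split_proj d rev.split h (split_proj d split h v)"
      by (simp only: proj[of "split1 d E Es", OF split1] proj[of "split2 d E Es", OF split2])
  qed (rule refl)

  have \<Psi>'_raise: "\<Psi>' (raise i j v) = s (vartheta ?\<theta> d j - vartheta ?\<theta> d i) (raise_pred i j v)"
    if ij: "2 * i \<le> d" "i \<le> j" "j \<le> d - i" "v \<in> K i" for i j v
  proof -
    let ?c = "1 / (?\<theta> 0 - ?\<theta> d)"
    have "\<Psi>' (raise i j v) = s (?c * (\<Sum>h\<in>{i..<j}. ?\<theta> h - ?\<theta> (d - h))) (raise_pred i j v)"
    proof (rule psi_formula_on_raise_K[OF assms(5) _ _ ij])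
      fix i x assume i: "i \<le> d" "x \<in> ?X i"
      then have "\<Psi>' x \<in> neighbour_sum d ?X i" using assms(6) by blast
      then show "\<Psi>' x \<in> span (\<Union>j\<in>{j. j \<le> d \<and> i \<le> j + 1 \<and> j \<le> i + 1}. ?X j)"
        unfolding neighbour_sum_def by (subst (asm) sumX) auto
    next
      fix i y assume i: "i \<le> d" "y \<in> ?Y i"
      have eq: "{j. j + 2 \<le> i} = {..<i - 1}" by auto
      have "\<Psi>' y - s ?c (delta y - y) \<in> (\<Sum>j | j + 2 \<le> i. ?Y j)"
        using assms(7)[OF i(1)] i(2) unfolding Delta by blast
      also have "(\<Sum>j | j + 2 \<le> i. ?Y j) = low (i - 1)"
        unfolding eq low_def by (rule sumY) (use i(1) in auto)
      finally show "\<Psi>' y - s ?c (delta y - y) \<in> low (i - 1)" .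
    qed
    also have "?c * (\<Sum>h\<in>{i..<j}. ?\<theta> h - ?\<theta> (d - h)) = vartheta ?\<theta> d j - vartheta ?\<theta> d i"
    proof -
      have "(\<Sum>h<j. f h) = (\<Sum>h<i. f h) + (\<Sum>h\<in>{i..<j}. f h)" for f :: "nat \<Rightarrow> 'k"
        using sum.atLeastLessThan_concat[of 0 i j f] ij(2) by (simp add: lessThan_atLeast0)
      then show ?thesis by (simp add: vartheta_def sum_distrib_left)
    qed
    finally show ?thesis .
  qed
  let ?defining = "\<lambda>P. Vector_Spaces.linear s s P \<and> (\<forall>i j. \<forall>v\<in>Kspace d E Es i.
    2 * i \<le> d \<longrightarrow> i \<le> j \<longrightarrow> j \<le> d - i \<longrightarrow>
      P (raise i j v) = s (vartheta ?\<theta> d j - vartheta ?\<theta> d i) (raise_pred i j v))"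
  have Psi: "Psi s d A E Es = (THE P. ?defining P)"
    by (simp only: Psi_def Let_def raise_def raise_pred_def)
  have "?defining \<Psi>'"
  proof (intro conjI allI ballI impI)
    fix i j v assume "v \<in> Kspace d E Es i" "2 * i \<le> d" "i \<le> j" "j \<le> d - i"
    then show "\<Psi>' (raise i j v) = s (vartheta ?\<theta> d j - vartheta ?\<theta> d i) (raise_pred i j v)"
      using Kspace[of i] by (intro \<Psi>'_raise) simp_all
  qed (rule assms(5))
  moreover have "P = \<Psi>'" if P: "?defining P" for P
  proof
    fix v
    let ?R = "{raise i j v |i j v. 2 * i \<le> d \<and> i \<le> j \<and> j \<le> d - i \<and> v \<in> K i}"
    interpret pair: vector_space_pair s s ..
    have lin: "Vector_Spaces.linear s s P" using P by (rule conjunct1)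
    have v: "v \<in> span ?R" by (simp only: span_raise_K UNIV_I)
    have "P b = \<Psi>' b" if mem: "b \<in> ?R" for b
    proof -
      obtain i j w where b: "b = raise i j w"
        and ij: "2 * i \<le> d" "i \<le> j" "j \<le> d - i" "w \<in> K i" using mem by blast
      have "w \<in> Kspace d E Es i" using ij Kspace[of i] by simp
      from P[THEN conjunct2, rule_format, OF this ij(1-3)]
      have "P b = s (vartheta ?\<theta> d j - vartheta ?\<theta> d i) (raise_pred i j w)"
        by (simp only: b)
      then show ?thesis using \<Psi>'_raise[OF ij] by (simp only: b)
    qed
    then show "P v = \<Psi>' v" by (rule pair.linear_eq_on[OF lin assms(5) v])
  qed
  ultimately show ?thesis unfolding Psi by (rule the_equality[symmetric])
qed

end
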